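(* For a fixed cut pool $\mathcal F'\subseteq\mathcal F$, a complete branch-and-price search (as described in the context) solves the corresponding restricted Benders master problem RBMP$(\mathcal F')$ exactly: every objective layer that the search certifies to be empty contains no feasible solution of RBMP$(\mathcal F')$ of that objective value, and, if RBMP$(\mathcal F')$ is feasible, the search finds an optimal solution of it.
   Context: $I=\{1,\dots,n\}$ is a finite set of items with areas $A_i>0$; bins have area $A$. $\mathcal F$ is the family of item subsets that cannot be packed geometrically into one bin (for this statement only a fixed family $\mathcal F'\subseteq\mathcal F$ of subsets of $I$ matters). $\mathcal P$ is the set of all patterns $p$, i.e. of item subsets $S(p)\subseteq I$ with $\sum_{i\in S(p)}A_i\le A$; $a_{ip}=1$ if $i\in S(p)$ and $0$ otherwise. RBMP$(\mathcal F')$ is: minimize $\sum_{p}\lambda_p$ subject to $\sum_p a_{ip}\lambda_p=1$ for all $i\in I$; $\sum_{p:S\subseteq S(p)}\lambda_p=0$ for all $S\in\mathcal F'$; $\lambda_p\in\{0,1\}$. **Branch-and-price search.** Starting from an integer $LB$ that is a valid lower bound on the optimal value of RBMP$(\mathcal F')$, objective layers $k=LB,LB+1,\dots$ are explored in order; at layer $k$ a tree search looks for an integer solution with objective value $k$, and the search moves to layer $k+1$ only when every node of the layer-$k$ tree has been fathomed or branched on without finding such a solution (layer $k$ is then certified empty). A node is given by a set of pairs of items required to be together and a set of pairs required to be separate (both empty at the root). Its admissible columns are the patterns containing no member of $\mathcal F'$, containing both or neither item of each "together" pair, and not both items of any "separate" pair. The node relaxation is: minimize $\sum\lambda_p$ subject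 to $\sum_pa_{ip}\lambda_p=1$ for all $i$, $\lambda_p\ge 0$, over admissible columns $p$ (for binary $\lambda$ and covering equalities, also imposing $\lambda_p\le1$ changes nothing). It is solved by column generation: the relaxation restricted to a subset $\mathcal P'$ of the admissible columns (the RMP) is solved, with optimal value $z^*_{RMP}$ and optimal dual values $\pi_i$ of the covering constraints; an exact pricing procedure computes the minimum reduced cost $c^*$ of $1-\sum_{i\in S(p)}\pi_i$ over admissible columns not in $\mathcal P'$; if $c^*<0$ a minimizing column is added to $\mathcal P'$ and the RMP is re-solved, while if no negative reduced-cost column exists the node relaxation is declared solved. A node is fathomed if it is infeasible, or if a lower bound on its relaxation exceeds $k$; in particular it is fathomed as soon as $c^*<0$ and $z^*_{RMP}>k(1-c^* )$. If the optimal solution of the node relaxation is integer with objective value $k$, it is returned. If it is fractional and the node is not fathomed, a pair $(i,j)$, $i\ne j$, with fractional co-assignment value $\rho_{ij}=\sum_{p\in\mathcal P':\,i,j\in S(p)}\lambda_p$ is selected (the one with $\rho_{ij}$ closest to a prescribed target $\tau$), and two child nodes are created, adding respectively the requirement that $i,j$ be together and that $i,j$ be separate. The search is complete if no node is discarded for any other reason. *)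

theory Defs
  imports Complex_Main "HOL-Library.Multiset"
begin

(* A pattern p is identified with its item set S(p). *)

type_synonym pattern = "nat set"

record bmp =
  n_items :: nat
  area :: "nat \<Rightarrow> real"
  bin_area :: real
  cut_pool :: "nat set set"

definition items :: "bmp \<Rightarrow> nat set" where
  "items J = {1..n_items J}"

definition patterns :: "bmp \<Rightarrow> pattern set" where
  "patterns J = {p. p \<subseteq> items J \<and> (\<Sum>i\<in>p. area J i) \<le> bin_area J}"

definition incid :: "nat \<Rightarrow> pattern \<Rightarrow> real" where
  "incid i p = (if i \<in> p then 1 else 0)"

definition rbmp_feasible :: "bmp \<Rightarrow> (pattern \<Rightarrow> real) \<Rightarrow> bool" where
  "rbmp_feasible J x \<longleftrightarrow>
     (\<forall>i\<in>items J. (\<Sum>p\<in>patterns J. incid i p * x p) = 1) \<and>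
     (\<forall>S\<in>cut_pool J. (\<Sum>p | p \<in> patterns J \<and> S \<subseteq> p. x p) = 0) \<and>
     (\<forall>p\<in>patterns J. x p \<in> {0, 1})"

definition rbmp_value :: "bmp \<Rightarrow> (pattern \<Rightarrow> real) \<Rightarrow> real" where
  "rbmp_value J x = (\<Sum>p\<in>patterns J. x p)"

definition rbmp_optimal :: "bmp \<Rightarrow> (pattern \<Rightarrow> real) \<Rightarrow> bool" where
  "rbmp_optimal J x \<longleftrightarrow>
     rbmp_feasible J x \<and> (\<forall>\<mu>. rbmp_feasible J \<mu> \<longrightarrow> rbmp_value J x \<le> rbmp_value J \<mu>)"

definition valid_lower_bound :: "bmp \<Rightarrow> int \<Rightarrow> bool" where
  "valid_lower_bound J LB \<longleftrightarrow>
     (\<forall>\<mu>. rbmp_feasible J \<mu> \<longrightarrow> real_of_int LB \<le> rbmp_value J \<mu>)"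

datatype node = Node (together: "(nat \<times> nat) set") (separate: "(nat \<times> nat) set")

definition admissible :: "bmp \<Rightarrow> node \<Rightarrow> pattern set" where
  "admissible J v = {p \<in> patterns J.
     (\<forall>S\<in>cut_pool J. \<not> S \<subseteq> p) \<and>
     (\<forall>(i, j)\<in>together v. i \<in> p \<longleftrightarrow> j \<in> p) \<and>
     (\<forall>(i, j)\<in>separate v. \<not> (i \<in> p \<and> j \<in> p))}"

(* The covering LP over a column set Q: the node relaxation when Q is the set of all
   admissible columns, a restricted master problem (RMP) when Q is a subset of it.
   Solutions are extended by 0 to all columns outside Q. *)

definition lp_feasible :: "bmp \<Rightarrow> pattern set \<Rightarrow> (pattern \<Rightarrow> real) \<Rightarrow> bool" where
  "lp_feasible J Q x \<longleftrightarrow>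
     (\<forall>i\<in>items J. (\<Sum>p\<in>Q. incid i p * x p) = 1) \<and>
     (\<forall>p\<in>Q. 0 \<le> x p) \<and> (\<forall>p. p \<notin> Q \<longrightarrow> x p = 0)"

definition lp_value :: "pattern set \<Rightarrow> (pattern \<Rightarrow> real) \<Rightarrow> real" where
  "lp_value Q x = (\<Sum>p\<in>Q. x p)"

definition lp_optimal :: "bmp \<Rightarrow> pattern set \<Rightarrow> (pattern \<Rightarrow> real) \<Rightarrow> bool" where
  "lp_optimal J Q x \<longleftrightarrow>
     lp_feasible J Q x \<and> (\<forall>\<mu>. lp_feasible J Q \<mu> \<longrightarrow> lp_value Q x \<le> lp_value Q \<mu>)"

(* The dual LP: the covering constraints are equalities, so its variables are free in sign. *)

definition dual_feasible :: "bmp \<Rightarrow> pattern set \<Rightarrow> (nat \<Rightarrow> real) \<Rightarrow> bool" where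
  "dual_feasible J Q \<pi> \<longleftrightarrow> (\<forall>p\<in>Q. (\<Sum>i\<in>items J. incid i p * \<pi> i) \<le> 1)"

definition dual_optimal :: "bmp \<Rightarrow> pattern set \<Rightarrow> (nat \<Rightarrow> real) \<Rightarrow> bool" where
  "dual_optimal J Q \<pi> \<longleftrightarrow>
     dual_feasible J Q \<pi> \<and>
     (\<forall>\<omega>. dual_feasible J Q \<omega> \<longrightarrow> (\<Sum>i\<in>items J. \<omega> i) \<le> (\<Sum>i\<in>items J. \<pi> i))"

definition reduced_cost :: "(nat \<Rightarrow> real) \<Rightarrow> pattern \<Rightarrow> real" where
  "reduced_cost \<pi> p = 1 - (\<Sum>i\<in>p. \<pi> i)"

definition relaxation_bound :: "bmp \<Rightarrow> node \<Rightarrow> real \<Rightarrow> bool" where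
  "relaxation_bound J v b \<longleftrightarrow>
     (\<forall>\<mu>. lp_feasible J (admissible J v) \<mu> \<longrightarrow> b \<le> lp_value (admissible J v) \<mu>)"

definition integral_solution :: "pattern set \<Rightarrow> (pattern \<Rightarrow> real) \<Rightarrow> bool" where
  "integral_solution Q x \<longleftrightarrow> (\<forall>p\<in>Q. x p \<in> \<int>)"

definition coassign :: "pattern set \<Rightarrow> (pattern \<Rightarrow> real) \<Rightarrow> nat \<Rightarrow> nat \<Rightarrow> real" where
  "coassign Q x i j = (\<Sum>p | p \<in> Q \<and> i \<in> p \<and> j \<in> p. x p)"

definition fractional_pairs :: "bmp \<Rightarrow> pattern set \<Rightarrow> (pattern \<Rightarrow> real) \<Rightarrow> (nat \<times> nat) set" where
  "fractional_pairs J Q x =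
     {(i, j). i \<in> items J \<and> j \<in> items J \<and> i \<noteq> j \<and> coassign Q x i j \<notin> \<int>}"

definition branching_pair ::
  "bmp \<Rightarrow> real \<Rightarrow> pattern set \<Rightarrow> (pattern \<Rightarrow> real) \<Rightarrow> nat \<times> nat \<Rightarrow> bool" where
  "branching_pair J \<tau> Q x =
     is_arg_min (\<lambda>(i, j). \<bar>coassign Q x i j - \<tau>\<bar>) (\<lambda>ij. ij \<in> fractional_pairs J Q x)"

(* priced J v Q z \<pi> c p: the RMP over Q has optimal value z and optimal duals \<pi>; the least
   reduced cost over the missing admissible columns is c, it is negative, and p attains it. *)

definition priced ::
  "bmp \<Rightarrow> node \<Rightarrow> pattern set \<Rightarrow> real \<Rightarrow> (nat \<Rightarrow> real) \<Rightarrow> real \<Rightarrow> pattern \<Rightarrow> bool" where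
  "priced J v Q z \<pi> c p \<longleftrightarrow>
     (\<exists>x. lp_optimal J Q x \<and> z = lp_value Q x) \<and> dual_optimal J Q \<pi> \<and>
     is_arg_min (reduced_cost \<pi>) (\<lambda>q. q \<in> admissible J v - Q) p \<and>
     c = reduced_cost \<pi> p \<and> c < 0"

(* The RMP over Q has optimal solution x and optimal duals for which no missing admissible
   column has negative reduced cost: the relaxation of v is declared solved. *)

definition declared_solved :: "bmp \<Rightarrow> node \<Rightarrow> pattern set \<Rightarrow> (pattern \<Rightarrow> real) \<Rightarrow> bool" where
  "declared_solved J v Q x \<longleftrightarrow>
     lp_optimal J Q x \<and>
     (\<exists>\<pi>. dual_optimal J Q \<pi> \<and> (\<forall>q\<in>admissible J v - Q. 0 \<le> reduced_cost \<pi> q))"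

(* Process v Q: node v is under treatment and Q is the current set of RMP columns. *)

datatype phase = Select | Process node "pattern set" | Returned "pattern \<Rightarrow> real"

datatype state = State
  (certified: "int set") (layer: int) (open_nodes: "node multiset") (phase: phase)

definition root :: node where
  "root = Node {} {}"

definition init :: "int \<Rightarrow> state" where
  "init LB = State {} LB {#root#} Select"

(* One step of the search. Everything the method leaves open is nondeterministic: the order
   of the nodes, the initial columns of a node, the optimal primal and dual solutions of the
   RMP, and all ties. The initial RMP of a feasible node is feasible, so that its optimal
   value and duals exist. There is no rule that discards a node except the fathoming rules;
   a layer is certified only when no open node is left. *)

inductive step :: "bmp \<Rightarrow> real \<Rightarrow> state \<Rightarrow> state \<Rightarrow> bool" for J \<tau> where
  fathom_infeasible:
    "\<nexists>\<mu>. lp_feasible J (admissible J v) \<mu> \<Longrightarrow>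
     step J \<tau> (State C k (add_mset v M) Select) (State C k M Select)"
| start:
    "Q \<subseteq> admissible J v \<Longrightarrow> \<exists>\<mu>. lp_feasible J Q \<mu> \<Longrightarrow>
     step J \<tau> (State C k (add_mset v M) Select) (State C k M (Process v Q))"
| fathom_bound:
    "relaxation_bound J v b \<Longrightarrow> b > real_of_int k \<Longrightarrow>
     step J \<tau> (State C k M (Process v Q)) (State C k M Select)"
| fathom_pricing:
    "priced J v Q z \<pi> c p \<Longrightarrow> z > real_of_int k * (1 - c) \<Longrightarrow>
     step J \<tau> (State C k M (Process v Q)) (State C k M Select)"
| add_column:
    "priced J v Q z \<pi> c p \<Longrightarrow> \<not> z > real_of_int k * (1 - c) \<Longrightarrow>
     step J \<tau> (State C k M (Process v Q)) (State C k M (Process v (insert p Q)))"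
| return_solution:
    "declared_solved J v Q x \<Longrightarrow> integral_solution Q x \<Longrightarrow> lp_value Q x = real_of_int k \<Longrightarrow>
     step J \<tau> (State C k M (Process v Q)) (State C k M (Returned x))"
| branch:
    "declared_solved J v Q x \<Longrightarrow> \<not> integral_solution Q x \<Longrightarrow> lp_value Q x \<le> real_of_int k \<Longrightarrow>
     branching_pair J \<tau> Q x (i, j) \<Longrightarrow>
     step J \<tau> (State C k M (Process v Q))
       (State C k
         (M + {#Node (insert (i, j) (together v)) (separate v),
                Node (together v) (insert (i, j) (separate v))#}) Select)"
| next_layer:
    "step J \<tau> (State C k {#} Select) (State (insert k C) (k + 1) {#root#} Select)"

definition reachable :: "bmp \<Rightarrow> real \<Rightarrow> int \<Rightarrow> state \<Rightarrow> bool" where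
  "reachable J \<tau> LB s \<longleftrightarrow> (step J \<tau>)\<^sup>*\<^sup>* (init LB) s"

definition halted :: "bmp \<Rightarrow> real \<Rightarrow> state \<Rightarrow> bool" where
  "halted J \<tau> s \<longleftrightarrow> (\<nexists>s'. step J \<tau> s s')"

definition infinite_run :: "bmp \<Rightarrow> real \<Rightarrow> int \<Rightarrow> (nat \<Rightarrow> state) \<Rightarrow> bool" where
  "infinite_run J \<tau> LB r \<longleftrightarrow> r 0 = init LB \<and> (\<forall>t. step J \<tau> (r t) (r (Suc t)))"

end

theory Submission imports Defs
begin

text \<open>
  Four facts make the search exact.

  First, every fathoming rule is justified by a lower bound on the node relaxation. For the
  rule that compares \<open>z\<close> with \<open>k * (1 - c)\<close> this is Farley's bound (lemma \<open>farley_bound\<close>): no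
  admissible column has reduced cost below \<open>c\<close>, so dividing the optimal duals of the restricted
  master by \<open>1 - c\<close> makes them dual feasible for all admissible columns, and the relaxation has
  value at least \<open>z / (1 - c)\<close>. The case \<open>c = 0\<close> shows that a relaxation declared solved is
  indeed solved. Both uses need the optimal dual value to equal \<open>z\<close>, that is, strong duality,
  which is derived from Farkas' lemma; the same theorem supplies the optimal primal and dual
  solutions without which the column generation could not go on.

  Second, branching loses no integer solution: in a partition, two items lie either in the same
  block or in different blocks (lemma \<open>complies_child\<close>).

  Third, branching is always possible at a fractional optimum. If no co-assignment value is
  fractional, all columns of positive weight that contain an item \<open>i\<close> coincide: an item \<open>j\<close> in
  one of them but not in another would give \<open>(i, j)\<close> a value strictly between 0 and 1. So this
  column has weight 1, and the empty column, which contains no item, has weight 0 at an optimum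
  (lemma \<open>fractional_pairs_nonempty\<close>).

  Fourth, the search terminates. A column is added once only, and a branching pair is new to
  both constraint sets of its node, which bounds the tree of a layer. By the first two facts, an
  integer solution whose value is the current layer complies with some node not yet fathomed, so
  a layer is left only if it contains no solution (lemma \<open>sound_step\<close>). Hence the layer index
  never exceeds the value of any feasible solution, and a solution returned at the current layer
  is optimal.

  Taken together: certified layers are empty, a sound state that is not final has a successor,
  and on a feasible instance every step decreases a lexicographic measure.
\<close>

section \<open>Duality for linear programs in equality form\<close>

text \<open>
  Induction on the set of functionals, after Bartl. Suppose the functional \<open>a l\<close> is needed,
  witnessed by a vector \<open>y0\<close> that satisfies the other inequalities but violates the conclusion.
  Then \<open>a l\<close> is positive at \<open>y0\<close>, so every vector can be projected along \<open>y0\<close> into the kernel of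
  \<open>a l\<close>. Composed with this projection the remaining functionals fulfil the hypothesis of the
  lemma on the whole space, and undoing the projection only adds a multiple of \<open>a l\<close>, which is
  nonnegative by the choice of \<open>y0\<close>.
\<close>

lemma farkas:
  fixes a :: "'k \<Rightarrow> 'i \<Rightarrow> real" and g :: "'i \<Rightarrow> real"
  assumes "finite K"
    and "\<And>y. \<forall>k\<in>K. (\<Sum>i\<in>I. a k i * y i) \<le> 0 \<Longrightarrow> (\<Sum>i\<in>I. g i * y i) \<le> 0"
    and "finite I"
  shows "\<exists>u. (\<forall>k\<in>K. 0 \<le> u k) \<and> (\<forall>i\<in>I. g i = (\<Sum>k\<in>K. u k * a k i))"
  using assms(1,2)
proof (induction K arbitrary: a g rule: finite_induct)
  case empty
  have "(\<Sum>i\<in>I. g i * g i) \<le> 0"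
    using empty[of g] by simp
  then have "(\<Sum>i\<in>I. g i * g i) = 0"
    by (intro antisym sum_nonneg) auto
  then have "\<forall>i\<in>I. g i = 0"
    using \<open>finite I\<close> by (subst (asm) sum_nonneg_eq_0_iff) auto
  then show ?case by simp
next
  case (insert l K)
  show ?case
  proof (cases "\<forall>y. (\<forall>k\<in>K. (\<Sum>i\<in>I. a k i * y i) \<le> 0) \<longrightarrow> (\<Sum>i\<in>I. g i * y i) \<le> 0")
    case True
    then obtain u where u: "\<forall>k\<in>K. 0 \<le> u k" "\<forall>i\<in>I. g i = (\<Sum>k\<in>K. u k * a k i)"
      using insert.IH[of a g] by blast
    have "(\<Sum>k\<in>insert l K. (u(l := 0)) k * a k i) = (\<Sum>k\<in>K. u k * a k i)" for i
      using insert.hyps by (auto intro!: sum.cong)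
    then show ?thesis
      using u by (intro exI[of _ "u(l := 0)"]) auto
  next
    case False
    then obtain y0 where y0: "\<forall>k\<in>K. (\<Sum>i\<in>I. a k i * y0 i) \<le> 0" "(\<Sum>i\<in>I. g i * y0 i) > 0"
      by (auto simp: not_le)
    define d where "d = (\<Sum>i\<in>I. a l i * y0 i)"
    have "d > 0"
      using insert.prems[of y0] y0 by (force simp: d_def not_le)
    define e where "e k = (\<Sum>i\<in>I. a k i * y0 i) / d" for k
    define f where "f = (\<Sum>i\<in>I. g i * y0 i) / d"
    \<comment> \<open>Applying a functional after the projection is the same as applying the functional corrected
      by a multiple of \<open>a l\<close>.\<close>
    have shift: "(\<Sum>i\<in>I. h i * (y i - (\<Sum>i\<in>I. a l i * y i) / d * y0 i)) =
        (\<Sum>i\<in>I. (h i - (\<Sum>i\<in>I. h i * y0 i) / d * a l i) * y i)" for h y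
      by (simp add: algebra_simps sum_subtractf sum_distrib_left sum_distrib_right sum_divide_distrib)
        (subst sum.swap, simp add: mult_ac)
    have "\<exists>u. (\<forall>k\<in>K. 0 \<le> u k) \<and>
        (\<forall>i\<in>I. g i - f * a l i = (\<Sum>k\<in>K. u k * (a k i - e k * a l i)))"
    proof (rule insert.IH)
      fix y assume y: "\<forall>k\<in>K. (\<Sum>i\<in>I. (a k i - e k * a l i) * y i) \<le> 0"
      define y' where "y' i = y i - (\<Sum>i\<in>I. a l i * y i) / d * y0 i" for i
      have "(\<Sum>i\<in>I. a l i * y' i) = 0"
        using shift[of "a l" y] \<open>d > 0\<close> unfolding y'_def d_def by simp
      moreover have "\<forall>k\<in>K. (\<Sum>i\<in>I. a k i * y' i) \<le> 0"
        using y shift[of "a _" y] unfolding y'_def e_def by simp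
      ultimately have "(\<Sum>i\<in>I. g i * y' i) \<le> 0"
        using insert.prems[of y'] by auto
      then show "(\<Sum>i\<in>I. (g i - f * a l i) * y i) \<le> 0"
        using shift[of g y] unfolding y'_def f_def by simp
    qed
    then obtain u where u: "\<forall>k\<in>K. 0 \<le> u k"
        "\<forall>i\<in>I. g i - f * a l i = (\<Sum>k\<in>K. u k * (a k i - e k * a l i))"
      by blast
    have "(\<Sum>k\<in>K. u k * e k) \<le> 0"
      using u(1) y0(1) \<open>d > 0\<close> by (intro sum_nonpos) (auto simp: e_def mult_nonneg_nonpos divide_nonpos_pos)
    moreover have "f \<ge> 0"
      using y0 \<open>d > 0\<close> by (simp add: f_def)
    moreover have "g i = (f - (\<Sum>k\<in>K. u k * e k)) * a l i + (\<Sum>k\<in>K. u k * a k i)" if "i \<in> I" for i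
    proof -
      have "(\<Sum>k\<in>K. u k * (a k i - e k * a l i)) = (\<Sum>k\<in>K. u k * a k i) - (\<Sum>k\<in>K. u k * e k) * a l i"
        by (simp add: algebra_simps sum_subtractf sum_distrib_left)
      then show ?thesis
        using u(2) that by (simp add: algebra_simps)
    qed
    moreover have "(\<Sum>k\<in>insert l K. (u(l := s)) k * a k i) = s * a l i + (\<Sum>k\<in>K. u k * a k i)" for i s
      using insert.hyps by (auto intro!: sum.cong)
    ultimately show ?thesis
      using u(1) by (intro exI[of _ "u(l := f - (\<Sum>k\<in>K. u k * e k))"]) auto
  qed
qed

lemma lp_weak_duality:
  fixes a :: "'i \<Rightarrow> 'p \<Rightarrow> real"
  assumes "\<forall>p\<in>Q. 0 \<le> x p" and "\<forall>i\<in>I. (\<Sum>p\<in>Q. a i p * x p) = b i"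
    and "\<forall>p\<in>Q. (\<Sum>i\<in>I. a i p * \<pi> i) \<le> c p"
  shows "(\<Sum>i\<in>I. b i * \<pi> i) \<le> (\<Sum>p\<in>Q. c p * x p)"
proof -
  have "(\<Sum>i\<in>I. b i * \<pi> i) = (\<Sum>i\<in>I. \<Sum>p\<in>Q. a i p * x p * \<pi> i)"
    using assms(2) by (simp flip: sum_distrib_right)
  also have "\<dots> = (\<Sum>p\<in>Q. (\<Sum>i\<in>I. a i p * \<pi> i) * x p)"
    by (subst sum.swap) (simp add: sum_distrib_right sum_distrib_left mult_ac)
  also have "\<dots> \<le> (\<Sum>p\<in>Q. c p * x p)"
    using assms by (intro sum_mono mult_right_mono) auto
  finally show ?thesis .
qed

text \<open>
  Farkas' lemma for the columns extended by their costs: row \<open>None\<close> carries the objective, and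
  the additional column \<open>None\<close> is the slack of the objective row. A vector \<open>y\<close> satisfying the
  homogeneous inequalities is, if \<open>y None\<close> is positive, a multiple of a dual solution; if
  \<open>y None = 0\<close>, it is a direction of recession of the dual, along which the dual objective
  cannot increase because the primal has the solution \<open>\<mu>\<close>.
\<close>

lemma lp_primal_attains_dual_bound:
  fixes a :: "'i \<Rightarrow> 'p \<Rightarrow> real"
  assumes "finite I" and "finite Q"
    and \<mu>: "\<forall>p\<in>Q. 0 \<le> \<mu> p" "\<forall>i\<in>I. (\<Sum>p\<in>Q. a i p * \<mu> p) = b i"
    and z: "\<And>\<omega>. \<forall>p\<in>Q. (\<Sum>i\<in>I. a i p * \<omega> i) \<le> c p \<Longrightarrow> (\<Sum>i\<in>I. b i * \<omega> i) \<le> z"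
  shows "\<exists>x. (\<forall>p\<in>Q. 0 \<le> x p) \<and> (\<forall>i\<in>I. (\<Sum>p\<in>Q. a i p * x p) = b i) \<and> (\<Sum>p\<in>Q. c p * x p) \<le> z"
proof -
  let ?K = "insert None (Some ` Q)" and ?I = "insert None (Some ` I)"
  define a' where "a' k j = (case (k, j) of (Some p, Some i) \<Rightarrow> a i p | (Some p, None) \<Rightarrow> - c p
    | (None, Some i) \<Rightarrow> 0 | (None, None) \<Rightarrow> - 1)" for k j
  define g where "g j = (case j of Some i \<Rightarrow> b i | None \<Rightarrow> - z)" for j
  have "\<exists>u. (\<forall>k\<in>?K. 0 \<le> u k) \<and> (\<forall>j\<in>?I. g j = (\<Sum>k\<in>?K. u k * a' k j))"
  proof (rule farkas)
    fix y assume y: "\<forall>k\<in>?K. (\<Sum>j\<in>?I. a' k j * y j) \<le> 0"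
    define s where "s = y None"
    define \<omega> where "\<omega> i = y (Some i)" for i
    have "s \<ge> 0" and y': "\<forall>p\<in>Q. (\<Sum>i\<in>I. a i p * \<omega> i) \<le> c p * s"
      using y \<open>finite I\<close> by (auto simp: sum.reindex a'_def s_def \<omega>_def)
    have "(\<Sum>i\<in>I. b i * \<omega> i) \<le> z * s"
    proof (cases "s = 0")
      case True
      then show ?thesis
        using lp_weak_duality[OF \<mu>, of \<omega> "\<lambda>_. 0"] y' by simp
    next
      case False
      with \<open>s \<ge> 0\<close> have "s > 0" by simp
      with y' have "\<forall>p\<in>Q. (\<Sum>i\<in>I. a i p * (\<omega> i / s)) \<le> c p"
        by (simp add: sum_divide_distrib[symmetric] pos_divide_le_eq)
      then have "(\<Sum>i\<in>I. b i * (\<omega> i / s)) \<le> z"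
        by (rule z)
      with \<open>s > 0\<close> show ?thesis
        by (simp add: sum_divide_distrib[symmetric] pos_divide_le_eq)
    qed
    then show "(\<Sum>j\<in>?I. g j * y j) \<le> 0"
      using \<open>finite I\<close> by (simp add: sum.reindex g_def s_def \<omega>_def)
  qed (use assms in auto)
  then obtain u where u: "\<forall>k\<in>?K. 0 \<le> u k" "\<forall>j\<in>?I. g j = (\<Sum>k\<in>?K. u k * a' k j)"
    by blast
  have "\<forall>i\<in>I. (\<Sum>p\<in>Q. a i p * u (Some p)) = b i"
    using u(2) \<open>finite Q\<close> by (auto simp: sum.reindex g_def a'_def mult.commute)
  moreover have "(\<Sum>p\<in>Q. c p * u (Some p)) \<le> z"
    using u \<open>finite Q\<close> by (simp add: sum.reindex g_def a'_def sum_negf mult.commute)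
  ultimately show ?thesis
    using u(1) by (intro exI[of _ "\<lambda>p. u (Some p)"]) auto
qed

text \<open>
  If the dual constraints together with the objective constraint at level \<open>z\<close> had no solution,
  then all solutions of their homogenisation would have \<open>y None \<le> 0\<close>, and Farkas' lemma would
  give multipliers for this. With \<open>t\<close> the multiplier of the objective constraint, the others,
  divided by \<open>t\<close>, form a primal solution of value \<open>z - 1 / t\<close>; and for \<open>t = 0\<close> they form a
  primal direction of negative cost, which the dual solution \<open>\<omega>\<close> excludes.
\<close>

lemma lp_dual_attains_primal_bound:
  fixes a :: "'i \<Rightarrow> 'p \<Rightarrow> real"
  assumes "finite I" and "finite Q"
    and \<omega>: "\<forall>p\<in>Q. (\<Sum>i\<in>I. a i p * \<omega> i) \<le> c p"
    and z: "\<And>x. \<forall>p\<in>Q. 0 \<le> x p \<Longrightarrow> \<forall>i\<in>I. (\<Sum>p\<in>Q. a i p * x p) = b i \<Longrightarrow> z \<le> (\<Sum>p\<in>Q. c p * x p)"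
  shows "\<exists>\<pi>. (\<forall>p\<in>Q. (\<Sum>i\<in>I. a i p * \<pi> i) \<le> c p) \<and> z \<le> (\<Sum>i\<in>I. b i * \<pi> i)"
proof (rule ccontr)
  assume none: "\<not> ?thesis"
  let ?K = "insert None (Some ` Q)" and ?I = "insert None (Some ` I)"
  define a' where "a' k j = (case (k, j) of (Some p, Some i) \<Rightarrow> a i p | (Some p, None) \<Rightarrow> - c p
    | (None, Some i) \<Rightarrow> - b i | (None, None) \<Rightarrow> z)" for k j
  define g :: "'i option \<Rightarrow> real" where "g j = (case j of Some i \<Rightarrow> 0 | None \<Rightarrow> 1)" for j
  have "\<exists>u. (\<forall>k\<in>?K. 0 \<le> u k) \<and> (\<forall>j\<in>?I. g j = (\<Sum>k\<in>?K. u k * a' k j))"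
  proof (rule farkas)
    fix y assume y: "\<forall>k\<in>?K. (\<Sum>j\<in>?I. a' k j * y j) \<le> 0"
    define s where "s = y None"
    define \<pi> where "\<pi> i = y (Some i)" for i
    have y': "\<forall>p\<in>Q. (\<Sum>i\<in>I. a i p * \<pi> i) \<le> c p * s" "z * s \<le> (\<Sum>i\<in>I. b i * \<pi> i)"
      using y \<open>finite I\<close> by (auto simp: sum.reindex a'_def s_def \<pi>_def sum_negf)
    have "s \<le> 0"
    proof (rule ccontr)
      assume "\<not> s \<le> 0"
      then have "\<forall>p\<in>Q. (\<Sum>i\<in>I. a i p * (\<pi> i / s)) \<le> c p" "z \<le> (\<Sum>i\<in>I. b i * (\<pi> i / s))"
        using y' by (simp_all add: sum_divide_distrib[symmetric] pos_divide_le_eq pos_le_divide_eq)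
      then show False using none by (auto dest!: spec[of _ "\<lambda>i. \<pi> i / s"])
    qed
    then show "(\<Sum>j\<in>?I. g j * y j) \<le> 0"
      using \<open>finite I\<close> by (simp add: sum.reindex g_def s_def)
  qed (use assms in auto)
  then obtain u where u: "\<forall>k\<in>?K. 0 \<le> u k" "\<forall>j\<in>?I. g j = (\<Sum>k\<in>?K. u k * a' k j)"
    by blast
  define t where "t = u None"
  define x where "x p = u (Some p)" for p
  have "t \<ge> 0" and x: "\<forall>p\<in>Q. 0 \<le> x p" "\<forall>i\<in>I. (\<Sum>p\<in>Q. a i p * x p) = t * b i"
      "(\<Sum>p\<in>Q. c p * x p) = t * z - 1"
    using u \<open>finite Q\<close>
    by (auto simp: sum.reindex g_def a'_def sum_negf mult.commute t_def x_def)
  show False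
  proof (cases "t = 0")
    case True
    then show False
      using lp_weak_duality[OF x(1,2) \<omega>] x(3) by simp
  next
    case False
    with \<open>t \<ge> 0\<close> have "t > 0" by simp
    then have "z \<le> (\<Sum>p\<in>Q. c p * (x p / t))"
      using x by (intro z) (simp_all add: sum_divide_distrib[symmetric])
    also have "\<dots> = (t * z - 1) / t"
      using x(3) by (simp add: sum_divide_distrib[symmetric])
    also have "\<dots> < z"
      using \<open>t > 0\<close> by (simp add: field_simps)
    finally show False by simp
  qed
qed

text \<open>
  Both optima are attained, at the supremum of the dual values: the two preceding lemmas give
  a primal solution not above it and a dual solution not below it.
\<close>

lemma lp_strong_duality:
  fixes a :: "'i \<Rightarrow> 'p \<Rightarrow> real"
  assumes "finite I" and "finite Q"
    and \<mu>: "\<forall>p\<in>Q. 0 \<le> \<mu> p" "\<forall>i\<in>I. (\<Sum>p\<in>Q. a i p * \<mu> p) = b i"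
    and \<omega>: "\<forall>p\<in>Q. (\<Sum>i\<in>I. a i p * \<omega> i) \<le> c p"
  obtains x \<pi> where "\<forall>p\<in>Q. 0 \<le> x p" "\<forall>i\<in>I. (\<Sum>p\<in>Q. a i p * x p) = b i"
    "\<forall>p\<in>Q. (\<Sum>i\<in>I. a i p * \<pi> i) \<le> c p" "(\<Sum>p\<in>Q. c p * x p) = (\<Sum>i\<in>I. b i * \<pi> i)"
proof -
  define D where "D = {(\<Sum>i\<in>I. b i * \<omega> i) |\<omega>. \<forall>p\<in>Q. (\<Sum>i\<in>I. a i p * \<omega> i) \<le> c p}"
  have "bdd_above D"
    using lp_weak_duality[OF \<mu>] by (auto simp: D_def bdd_above_def)
  then have "(\<Sum>i\<in>I. b i * \<omega> i) \<le> Sup D" if "\<forall>p\<in>Q. (\<Sum>i\<in>I. a i p * \<omega> i) \<le> c p" for \<omega>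
    using that by (intro cSup_upper) (auto simp: D_def)
  from lp_primal_attains_dual_bound[OF assms(1-4) this]
  obtain x where x: "\<forall>p\<in>Q. 0 \<le> x p" "\<forall>i\<in>I. (\<Sum>p\<in>Q. a i p * x p) = b i" "(\<Sum>p\<in>Q. c p * x p) \<le> Sup D"
    by blast
  have "Sup D \<le> (\<Sum>p\<in>Q. c p * x' p)"
    if "\<forall>p\<in>Q. 0 \<le> x' p" "\<forall>i\<in>I. (\<Sum>p\<in>Q. a i p * x' p) = b i" for x'
    using lp_weak_duality[OF that] \<omega> by (intro cSup_least) (auto simp: D_def)
  from lp_dual_attains_primal_bound[OF assms(1,2) \<omega> this]
  obtain \<pi> where \<pi>: "\<forall>p\<in>Q. (\<Sum>i\<in>I. a i p * \<pi> i) \<le> c p" "Sup D \<le> (\<Sum>i\<in>I. b i * \<pi> i)"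
    by blast
  from that x \<pi> lp_weak_duality[OF x(1,2) \<pi>(1)] show thesis
    by force
qed


section \<open>The covering relaxation\<close>

lemma finite_items: "finite (items J)"
  by (simp add: items_def)

lemma patterns_subset: "patterns J \<subseteq> Pow (items J)"
  by (auto simp: patterns_def)

lemma finite_patterns: "finite (patterns J)"
  by (rule finite_subset[OF patterns_subset]) (simp add: finite_items)

lemma admissible_subset: "admissible J v \<subseteq> patterns J"
  by (auto simp: admissible_def)

lemmas admissible_items = subset_trans[OF admissible_subset patterns_subset]

lemmas finite_admissible = finite_subset[OF admissible_subset finite_patterns]

lemma finite_columns: "Q \<subseteq> Pow (items J) \<Longrightarrow> finite Q"
  by (rule finite_subset) (auto simp: finite_items)

lemma sum_incid:
  "finite Q \<Longrightarrow> (\<Sum>p\<in>Q. incid i p * x p) = (\<Sum>p | p \<in> Q \<and> i \<in> p. x p)"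
  by (auto simp: sum.inter_filter incid_def intro!: sum.cong)

lemma dual_row_reduced_cost:
  assumes "p \<subseteq> items J"
  shows "(\<Sum>i\<in>items J. incid i p * \<pi> i) = 1 - reduced_cost \<pi> p"
proof -
  have "(\<Sum>i\<in>items J. incid i p * \<pi> i) = (\<Sum>i\<in>p. incid i p * \<pi> i)"
    using assms by (intro sum.mono_neutral_right) (auto simp: finite_items incid_def)
  then show ?thesis
    by (simp add: reduced_cost_def incid_def)
qed

lemma covering_weak_duality:
  assumes "lp_feasible J Q x" and "dual_feasible J Q \<pi>"
  shows "(\<Sum>i\<in>items J. \<pi> i) \<le> lp_value Q x"
  using lp_weak_duality[of Q x "items J" incid "\<lambda>_. 1" \<pi> "\<lambda>_. 1"] assms
  by (simp add: lp_feasible_def dual_feasible_def lp_value_def)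

text \<open>
  The zero vector is dual feasible, so primal feasibility alone gives optimal solutions on both
  sides.
\<close>

lemma covering_strong_duality:
  assumes "Q \<subseteq> Pow (items J)" and "lp_feasible J Q \<mu>"
  obtains x \<pi> where "lp_optimal J Q x" "dual_optimal J Q \<pi>" "lp_value Q x = (\<Sum>i\<in>items J. \<pi> i)"
proof -
  have \<mu>: "\<forall>p\<in>Q. 0 \<le> \<mu> p" "\<forall>i\<in>items J. (\<Sum>p\<in>Q. incid i p * \<mu> p) = 1"
    using assms(2) by (simp_all add: lp_feasible_def)
  have zero: "\<forall>p\<in>Q. (\<Sum>i\<in>items J. incid i p * 0) \<le> 1"
    by simp
  obtain x \<pi> where x: "\<forall>p\<in>Q. 0 \<le> x p" "\<forall>i\<in>items J. (\<Sum>p\<in>Q. incid i p * x p) = 1"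
    and \<pi>: "\<forall>p\<in>Q. (\<Sum>i\<in>items J. incid i p * \<pi> i) \<le> 1"
    and eq: "(\<Sum>p\<in>Q. 1 * x p) = (\<Sum>i\<in>items J. 1 * \<pi> i)"
    using lp_strong_duality[where a = incid and b = "\<lambda>_. 1" and c = "\<lambda>_. 1" and \<omega> = "\<lambda>_. 0",
        OF finite_items finite_columns[OF assms(1)] \<mu> zero]
    by blast
  define x' where "x' p = (if p \<in> Q then x p else 0)" for p
  have "lp_feasible J Q x'"
    using x by (simp add: lp_feasible_def x'_def)
  moreover have "dual_feasible J Q \<pi>"
    using \<pi> by (simp add: dual_feasible_def)
  moreover have "lp_value Q x' = (\<Sum>i\<in>items J. \<pi> i)"
    using eq by (simp add: lp_value_def x'_def)
  ultimately show thesis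
    using covering_weak_duality[of J Q] that[of x' \<pi>]
    by (fastforce simp: lp_optimal_def dual_optimal_def)
qed

lemma optimal_values_agree:
  assumes "Q \<subseteq> Pow (items J)" and "lp_optimal J Q x" and "dual_optimal J Q \<pi>"
  shows "lp_value Q x = (\<Sum>i\<in>items J. \<pi> i)"
proof -
  obtain x' \<pi>' where opt: "lp_optimal J Q x'" "dual_optimal J Q \<pi>'"
    and eq: "lp_value Q x' = (\<Sum>i\<in>items J. \<pi>' i)"
    using assms covering_strong_duality unfolding lp_optimal_def by blast
  have "lp_value Q x = lp_value Q x'"
    using assms(2) opt(1) by (auto simp: lp_optimal_def intro: antisym)
  moreover have "(\<Sum>i\<in>items J. \<pi> i) = (\<Sum>i\<in>items J. \<pi>' i)"
    using assms(3) opt(2) by (auto simp: dual_optimal_def intro: antisym)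
  ultimately show ?thesis
    using eq by simp
qed

text \<open>
  Since \<open>1 - c \<ge> 1\<close>, the duals divided by \<open>1 - c\<close> respect the dual constraint of every column:
  the columns in \<open>Q\<close> already did so before the division, and for the others the left-hand side
  was at most \<open>1 - c\<close>. Weak duality over \<open>P\<close> and strong duality over \<open>Q\<close> then give the bound.
\<close>

lemma farley_bound:
  assumes "Q \<subseteq> P" and "P \<subseteq> Pow (items J)"
    and x: "lp_optimal J Q x" and \<pi>: "dual_optimal J Q \<pi>"
    and c: "c \<le> 0" "\<forall>q\<in>P - Q. c \<le> reduced_cost \<pi> q"
    and \<mu>: "lp_feasible J P \<mu>"
  shows "lp_value Q x \<le> (1 - c) * lp_value P \<mu>"
proof -
  have "dual_feasible J P (\<lambda>i. \<pi> i / (1 - c))"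
    unfolding dual_feasible_def
  proof
    fix p assume "p \<in> P"
    have "(\<Sum>i\<in>items J. incid i p * \<pi> i) \<le> 1 - c"
    proof (cases "p \<in> Q")
      case True
      then show ?thesis
        using \<pi> c(1) by (fastforce simp: dual_optimal_def dual_feasible_def)
    next
      case False
      then show ?thesis
        using \<open>p \<in> P\<close> c(2) assms(2) by (subst dual_row_reduced_cost) auto
    qed
    then show "(\<Sum>i\<in>items J. incid i p * (\<pi> i / (1 - c))) \<le> 1"
      using c(1) by (simp add: sum_divide_distrib[symmetric])
  qed
  then have "(\<Sum>i\<in>items J. \<pi> i / (1 - c)) \<le> lp_value P \<mu>"
    using \<mu> by (rule covering_weak_duality[rotated])
  moreover have "lp_value Q x = (\<Sum>i\<in>items J. \<pi> i)"
    using assms by (intro optimal_values_agree) auto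
  ultimately show ?thesis
    using c(1) by (simp add: sum_divide_distrib[symmetric] pos_divide_le_eq mult.commute)
qed

lemma lp_feasible_insert:
  assumes "finite Q" and "lp_feasible J Q x"
  shows "lp_feasible J (insert p Q) x"
  using assms by (cases "p \<in> Q") (auto simp: lp_feasible_def insert_absorb)

lemma declared_solved_bound:
  assumes "Q \<subseteq> admissible J v" and "declared_solved J v Q x"
  shows "relaxation_bound J v (lp_value Q x)"
  using farley_bound[OF assms(1) admissible_items, of x _ 0] assms(2)
  by (auto simp: relaxation_bound_def declared_solved_def)

lemma priced_bound:
  assumes "Q \<subseteq> admissible J v" and "priced J v Q z \<pi> c p"
    and "lp_feasible J (admissible J v) \<mu>"
  shows "z \<le> lp_value (admissible J v) \<mu> * (1 - c)"
proof -
  have "\<forall>q\<in>admissible J v - Q. c \<le> reduced_cost \<pi> q"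
    using assms(2) by (auto simp: priced_def is_arg_min_def not_less)
  then show ?thesis
    using farley_bound[OF assms(1) admissible_items, of _ \<pi> c] assms(2,3)
    by (auto simp: priced_def mult.commute)
qed

text \<open>
  The empty column covers nothing and costs 1. It has to be treated separately because no
  covering constraint bounds its weight.
\<close>

lemma optimal_omits_empty_column:
  assumes "finite Q" and "lp_optimal J Q x"
  shows "x {} = 0"
proof (rule ccontr)
  assume "x {} \<noteq> 0"
  then have "{} \<in> Q" "x {} > 0"
    using assms(2) by (force simp: lp_optimal_def lp_feasible_def)+
  have "(\<Sum>p\<in>Q. incid i p * (x({} := 0)) p) = (\<Sum>p\<in>Q. incid i p * x p)" for i
    by (intro sum.cong) (auto simp: incid_def)
  then have "lp_feasible J Q (x({} := 0))"
    using assms(2) by (simp add: lp_optimal_def lp_feasible_def)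
  then have "lp_value Q x \<le> lp_value Q (x({} := 0))"
    using assms(2) by (simp add: lp_optimal_def)
  also have "\<dots> < lp_value Q x"
    unfolding lp_value_def using \<open>{} \<in> Q\<close> \<open>x {} > 0\<close> assms(1)
    by (intro sum_strict_mono_ex1) auto
  finally show False by simp
qed

lemma column_le_one:
  assumes "Q \<subseteq> Pow (items J)" and "lp_feasible J Q x" and "p \<in> Q" and "p \<noteq> {}"
  shows "x p \<le> 1"
proof -
  obtain i where "i \<in> p" using assms(4) by blast
  then have "x p \<le> (\<Sum>q | q \<in> Q \<and> i \<in> q. x q)"
    using assms finite_columns[OF assms(1)]
    by (intro member_le_sum) (auto simp: lp_feasible_def)
  also have "\<dots> = 1"
    using assms \<open>i \<in> p\<close> finite_columns[OF assms(1)]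
    by (subst sum_incid[symmetric]) (auto simp: lp_feasible_def)
  finally show ?thesis .
qed

section \<open>Branching pairs\<close>

text \<open>
  The columns containing \<open>i\<close> have total weight 1; the co-assignment value counts \<open>p\<close> among them
  and leaves out \<open>q\<close>.
\<close>

lemma coassign_strictly_between:
  assumes "Q \<subseteq> Pow (items J)" and x: "lp_feasible J Q x"
    and "p \<in> Q" "q \<in> Q" "x p > 0" "x q > 0"
    and "i \<in> p" "i \<in> q" "j \<in> p" "j \<notin> q"
  shows "0 < coassign Q x i j" and "coassign Q x i j < 1"
proof -
  note fin = finite_columns[OF assms(1)]
  have nn: "\<forall>p\<in>Q. 0 \<le> x p"
    using x by (simp add: lp_feasible_def)
  have "x p \<le> coassign Q x i j"
    unfolding coassign_def using assms nn fin by (intro member_le_sum) auto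
  with \<open>x p > 0\<close> show "0 < coassign Q x i j" by simp
  have "coassign Q x i j < (\<Sum>r | r \<in> Q \<and> i \<in> r. x r)"
    unfolding coassign_def using assms nn fin by (intro sum_strict_mono2[of _ _ q]) auto
  also have "\<dots> = 1"
    using assms fin by (subst sum_incid[symmetric]) (auto simp: lp_feasible_def)
  finally show "coassign Q x i j < 1" .
qed

lemma not_Ints_between: "0 < (r::real) \<Longrightarrow> r < 1 \<Longrightarrow> r \<notin> \<int>"
  by (auto elim!: Ints_cases)

lemma fractional_pairs_nonempty:
  assumes "Q \<subseteq> Pow (items J)" and opt: "lp_optimal J Q x" and "\<not> integral_solution Q x"
  shows "fractional_pairs J Q x \<noteq> {}"
proof
  assume none: "fractional_pairs J Q x = {}"
  note fin = finite_columns[OF assms(1)]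
  have x: "lp_feasible J Q x"
    using opt by (simp add: lp_optimal_def)
  obtain p where p: "p \<in> Q" "x p \<notin> \<int>"
    using assms(3) by (auto simp: integral_solution_def)
  then have "p \<noteq> {}" and "x p > 0"
    using optimal_omits_empty_column[OF fin opt] x by (force simp: lp_feasible_def less_le)+
  then obtain i where i: "i \<in> p" by blast
  have no_split: False
    if "q \<in> Q" "r \<in> Q" "x q > 0" "x r > 0" "i \<in> q" "i \<in> r" "j \<in> q" "j \<notin> r" for q r j
  proof -
    have "(i, j) \<in> fractional_pairs J Q x"
      using coassign_strictly_between[OF assms(1) x that] that assms(1)
      by (auto simp: fractional_pairs_def not_Ints_between)
    with none show False by simp
  qed
  have zero: "x q = 0" if "q \<in> Q" "i \<in> q" "q \<noteq> p" for q
  proof (rule ccontr)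
    assume "x q \<noteq> 0"
    with x that have "x q > 0" by (auto simp: lp_feasible_def less_le)
    then show False
      using that p i \<open>x p > 0\<close> no_split[of p q] no_split[of q p] by blast
  qed
  have "1 = (\<Sum>q | q \<in> Q \<and> i \<in> q. x q)"
    using x i p assms(1) fin by (subst sum_incid[symmetric]) (auto simp: lp_feasible_def)
  also have "\<dots> = (\<Sum>q\<in>{p}. x q)"
    using p i zero fin by (intro sum.mono_neutral_right) auto
  finally have "x p = 1" by simp
  with p(2) show False by simp
qed

lemma branching_pair_exists:
  assumes "fractional_pairs J Q x \<noteq> {}"
  shows "\<exists>i j. branching_pair J \<tau> Q x (i, j)"
proof -
  have "finite (fractional_pairs J Q x)"
    by (rule finite_subset[of _ "items J \<times> items J"]) (auto simp: fractional_pairs_def finite_items)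
  from ex_is_arg_min_if_finite[OF this assms] show ?thesis
    unfolding branching_pair_def by (metis surj_pair)
qed

text \<open>
  For a pair already required to be together the co-assignment value is the covering sum 1, and
  for a pair required to be separate it is 0, so neither is fractional. This is what makes each
  branching reduce the number of undecided pairs.
\<close>

lemma branching_pair_undecided:
  assumes "Q \<subseteq> admissible J v" and x: "lp_feasible J Q x" and "branching_pair J \<tau> Q x (i, j)"
  shows "i \<in> items J" "j \<in> items J" "(i, j) \<notin> together v" "(i, j) \<notin> separate v"
proof -
  have frac: "(i, j) \<in> fractional_pairs J Q x"
    using assms(3) by (simp add: branching_pair_def is_arg_min_def)
  then show "i \<in> items J" "j \<in> items J"
    by (auto simp: fractional_pairs_def)
  show "(i, j) \<notin> together v"
  proof
    assume "(i, j) \<in> together v"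
    then have "{p. p \<in> Q \<and> i \<in> p \<and> j \<in> p} = {p. p \<in> Q \<and> i \<in> p}"
      using assms(1) by (auto simp: admissible_def)
    then have "coassign Q x i j = (\<Sum>p\<in>Q. incid i p * x p)"
      using finite_subset[OF assms(1) finite_admissible] by (simp add: coassign_def sum_incid)
    with x \<open>i \<in> items J\<close> frac show False
      by (simp add: lp_feasible_def fractional_pairs_def)
  qed
  show "(i, j) \<notin> separate v"
  proof
    assume "(i, j) \<in> separate v"
    then have "{p. p \<in> Q \<and> i \<in> p \<and> j \<in> p} = {}"
      using assms(1) by (auto simp: admissible_def)
    with frac show False
      by (simp add: fractional_pairs_def coassign_def)
  qed
qed

section \<open>Integer solutions and nodes\<close>

lemma rbmp_binary:
  assumes "rbmp_feasible J \<mu>" and "p \<in> patterns J"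
  shows "\<mu> p \<in> {0, 1}"
  using assms by (simp add: rbmp_feasible_def)

lemma rbmp_nonneg: "rbmp_feasible J \<mu> \<Longrightarrow> p \<in> patterns J \<Longrightarrow> 0 \<le> \<mu> p"
  using rbmp_binary by fastforce

lemma rbmp_value_int:
  assumes "rbmp_feasible J \<mu>"
  obtains m :: int where "rbmp_value J \<mu> = real_of_int m"
proof -
  have "rbmp_value J \<mu> \<in> \<int>"
    unfolding rbmp_value_def using rbmp_binary[OF assms] by (intro Ints_sum) fastforce
  then show thesis
    using that by (auto elim: Ints_cases)
qed

lemma rbmp_avoids_cuts:
  assumes \<mu>: "rbmp_feasible J \<mu>" and "p \<in> patterns J" "S \<in> cut_pool J" "S \<subseteq> p"
  shows "\<mu> p = 0"
proof -
  have "(\<Sum>p | p \<in> patterns J \<and> S \<subseteq> p. \<mu> p) = 0"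
    using assms by (simp add: rbmp_feasible_def)
  then have "\<forall>p\<in>{p. p \<in> patterns J \<and> S \<subseteq> p}. \<mu> p = 0"
    using rbmp_nonneg[OF \<mu>] finite_patterns by (subst (asm) sum_nonneg_eq_0_iff) auto
  with assms show ?thesis by blast
qed

lemma rbmp_pattern_unique:
  assumes \<mu>: "rbmp_feasible J \<mu>" and "p \<in> patterns J" "q \<in> patterns J" "\<mu> p \<noteq> 0" "\<mu> q \<noteq> 0"
    and "i \<in> p" "i \<in> q"
  shows "p = q"
proof (rule ccontr)
  assume "p \<noteq> q"
  moreover have "\<mu> p = 1" "\<mu> q = 1"
    using rbmp_binary[OF \<mu>] assms by blast+
  ultimately have "2 = (\<Sum>r\<in>{p, q}. \<mu> r)"
    by simp
  also have "\<dots> \<le> (\<Sum>r | r \<in> patterns J \<and> i \<in> r. \<mu> r)"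
    using assms rbmp_nonneg[OF \<mu>] finite_patterns by (intro sum_mono2) auto
  also have "\<dots> = 1"
    using assms patterns_subset[of J] finite_patterns
    by (subst sum_incid[symmetric]) (auto simp: rbmp_feasible_def)
  finally show False by simp
qed

text \<open>
  An integer solution that survives at a node, in the sense that its support consists of
  admissible columns. Values outside the patterns are unconstrained.
\<close>

definition complies :: "bmp \<Rightarrow> node \<Rightarrow> (pattern \<Rightarrow> real) \<Rightarrow> bool" where
  "complies J v \<mu> \<longleftrightarrow> rbmp_feasible J \<mu> \<and> (\<forall>p\<in>patterns J. \<mu> p \<noteq> 0 \<longrightarrow> p \<in> admissible J v)"

lemma complies_root: "rbmp_feasible J \<mu> \<Longrightarrow> complies J root \<mu>"
  using rbmp_avoids_cuts by (auto simp: complies_def admissible_def root_def)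

lemma complies_child:
  assumes "complies J v \<mu>"
  shows "complies J (Node (insert (i, j) (together v)) (separate v)) \<mu> \<or>
    complies J (Node (together v) (insert (i, j) (separate v))) \<mu>"
proof (cases "\<exists>q\<in>patterns J. \<mu> q \<noteq> 0 \<and> i \<in> q \<and> j \<in> q")
  case True
  then obtain q where q: "q \<in> patterns J" "\<mu> q \<noteq> 0" "i \<in> q" "j \<in> q" by blast
  have "i \<in> p \<longleftrightarrow> j \<in> p" if "p \<in> patterns J" "\<mu> p \<noteq> 0" for p
    using rbmp_pattern_unique[of J \<mu> p q] that q assms by (auto simp: complies_def)
  then show ?thesis
    using assms by (auto simp: complies_def admissible_def)
next
  case False
  then show ?thesis
    using assms by (auto simp: complies_def admissible_def)
qed

lemma complies_lp_feasible:
  assumes "complies J v \<mu>"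
  obtains \<nu> where "lp_feasible J (admissible J v) \<nu>" "lp_value (admissible J v) \<nu> = rbmp_value J \<mu>"
proof -
  define \<nu> where "\<nu> p = (if p \<in> admissible J v then \<mu> p else 0)" for p
  have sums: "(\<Sum>p\<in>admissible J v. f p * \<nu> p) = (\<Sum>p\<in>patterns J. f p * \<mu> p)" for f :: "pattern \<Rightarrow> real"
    using assms admissible_subset finite_patterns
    by (intro sum.mono_neutral_cong_left) (auto simp: \<nu>_def complies_def)
  have "rbmp_feasible J \<mu>"
    using assms by (simp add: complies_def)
  then have "lp_feasible J (admissible J v) \<nu>"
    using rbmp_nonneg[of J \<mu>] admissible_subset
    by (auto simp: lp_feasible_def sums rbmp_feasible_def) (auto simp: \<nu>_def)
  moreover have "lp_value (admissible J v) \<nu> = rbmp_value J \<mu>"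
    using sums[of "\<lambda>_. 1"] by (simp add: lp_value_def rbmp_value_def)
  ultimately show thesis by (rule that)
qed

text \<open>
  The covering constraints bound every nonempty column by 1, optimality removes the empty
  column, and admissible columns contain no cut. Optimality matters: an integral solution that is
  merely feasible could use the empty column with weight 2.
\<close>

lemma integral_optimum_solves_rbmp:
  assumes "Q \<subseteq> admissible J v" and opt: "lp_optimal J Q x" and int: "integral_solution Q x"
  shows "rbmp_feasible J x" and "rbmp_value J x = lp_value Q x"
proof -
  have sub: "Q \<subseteq> Pow (items J)"
    using assms(1) admissible_items by blast
  have x: "lp_feasible J Q x"
    using opt by (simp add: lp_optimal_def)
  have sums: "(\<Sum>p\<in>patterns J. f p * x p) = (\<Sum>p\<in>Q. f p * x p)" for f :: "pattern \<Rightarrow> real"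
    using x assms(1) admissible_subset finite_patterns
    by (intro sum.mono_neutral_right) (auto simp: lp_feasible_def)
  have "x p \<in> {0, 1}" for p
  proof (cases "p \<in> Q \<and> p \<noteq> {}")
    case True
    then have "x p \<in> \<int>" "0 \<le> x p" "x p \<le> 1"
      using int x column_le_one[OF sub x] by (auto simp: integral_solution_def lp_feasible_def)
    then show ?thesis
      by (auto elim!: Ints_cases)
  next
    case False
    then show ?thesis
      using x optimal_omits_empty_column[OF finite_columns[OF sub] opt] by (auto simp: lp_feasible_def)
  qed
  moreover have "(\<Sum>p | p \<in> patterns J \<and> S \<subseteq> p. x p) = 0" if "S \<in> cut_pool J" for S
    using that x assms(1) by (intro sum.neutral) (auto simp: lp_feasible_def admissible_def)
  ultimately show "rbmp_feasible J x"
    using x by (simp add: rbmp_feasible_def sums lp_feasible_def)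
  show "rbmp_value J x = lp_value Q x"
    using sums[of "\<lambda>_. 1"] by (simp add: lp_value_def rbmp_value_def)
qed

section \<open>The search\<close>

text \<open>
  The node under treatment has left the multiset of open nodes but still has to account for its
  integer solutions.
\<close>

definition pending :: "state \<Rightarrow> node multiset" where
  "pending s = open_nodes s + (case phase s of Process v Q \<Rightarrow> {#v#} | _ \<Rightarrow> {#})"

definition covered :: "bmp \<Rightarrow> state \<Rightarrow> bool" where
  "covered J s \<longleftrightarrow> (\<forall>\<mu>. rbmp_feasible J \<mu> \<and> rbmp_value J \<mu> = real_of_int (layer s) \<longrightarrow>
     (\<exists>v\<in>#pending s. complies J v \<mu>))"

text \<open>
  The invariant of the search. The second conjunct carries the emptiness of all layers below the
  current one; it starts as the validity of the initial lower bound and, at a change of layer, is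
  improved by 1 because all values are integers.
\<close>

definition sound :: "bmp \<Rightarrow> state \<Rightarrow> bool" where
  "sound J s \<longleftrightarrow>
     (\<forall>k\<in>certified s. k < layer s) \<and>
     (\<forall>\<mu>. rbmp_feasible J \<mu> \<longrightarrow> real_of_int (layer s) \<le> rbmp_value J \<mu>) \<and>
     (case phase s of
        Select \<Rightarrow> covered J s
      | Process v Q \<Rightarrow> covered J s \<and> Q \<subseteq> admissible J v \<and> (\<exists>\<mu>. lp_feasible J Q \<mu>)
      | Returned x \<Rightarrow> rbmp_feasible J x \<and> rbmp_value J x = real_of_int (layer s))"

lemma covered_fathom:
  assumes "covered J s" and "layer s' = layer s" and "pending s = add_mset v (pending s')"
    and "\<And>\<nu>. lp_feasible J (admissible J v) \<nu> \<Longrightarrow>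
      real_of_int (layer s) < lp_value (admissible J v) \<nu>"
  shows "covered J s'"
  unfolding covered_def
proof (intro allI impI)
  fix \<mu> assume \<mu>: "rbmp_feasible J \<mu> \<and> rbmp_value J \<mu> = real_of_int (layer s')"
  have "\<not> complies J v \<mu>"
    using assms(2,4) \<mu> by (metis complies_lp_feasible less_irrefl)
  then show "\<exists>v\<in>#pending s'. complies J v \<mu>"
    using assms \<mu> by (auto simp: covered_def)
qed

lemma sound_step:
  assumes "step J \<tau> s s'" and "sound J s"
  shows "sound J s'"
  using assms
proof (cases rule: step.cases)
  case (fathom_infeasible v C k M)
  then have "covered J s'"
    using assms(2) by (intro covered_fathom[of J s s' v]) (auto simp: sound_def pending_def)
  then show ?thesis
    using assms(2) fathom_infeasible by (simp add: sound_def)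
next
  case (start Q v C k M)
  then show ?thesis
    using assms(2) by (auto simp: sound_def covered_def pending_def)
next
  case (fathom_bound v b k C M Q)
  then have "covered J s'"
    using assms(2)
    by (intro covered_fathom[of J s s' v]) (force simp: sound_def pending_def relaxation_bound_def)+
  then show ?thesis
    using assms(2) fathom_bound by (simp add: sound_def)
next
  case (fathom_pricing v Q z \<pi> c p k C M)
  have "real_of_int k < lp_value (admissible J v) \<nu>" if "lp_feasible J (admissible J v) \<nu>" for \<nu>
  proof -
    have "z \<le> lp_value (admissible J v) \<nu> * (1 - c)"
      using assms(2) fathom_pricing that by (intro priced_bound) (auto simp: sound_def)
    moreover have "c < 0"
      using fathom_pricing by (simp add: priced_def)
    ultimately show ?thesis
      using fathom_pricing(4) by (smt (verit) mult_right_mono)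
  qed
  then have "covered J s'"
    using assms(2) fathom_pricing
    by (intro covered_fathom[of J s s' v]) (auto simp: sound_def pending_def)
  then show ?thesis
    using assms(2) fathom_pricing by (simp add: sound_def)
next
  case (add_column v Q z \<pi> c p k C M)
  then have "p \<in> admissible J v"
    by (simp add: priced_def is_arg_min_def)
  moreover from add_column assms(2) obtain \<mu> where "Q \<subseteq> admissible J v" "lp_feasible J Q \<mu>"
    by (auto simp: sound_def)
  ultimately have "insert p Q \<subseteq> admissible J v" "lp_feasible J (insert p Q) \<mu>"
    using lp_feasible_insert finite_subset[OF _ finite_admissible] by auto
  then show ?thesis
    using assms(2) add_column by (auto simp: sound_def covered_def pending_def)
next
  case (return_solution v Q x k C M)
  then have "rbmp_feasible J x" "rbmp_value J x = lp_value Q x"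
    using integral_optimum_solves_rbmp[of Q J v x] assms(2)
    by (auto simp: sound_def declared_solved_def)
  then show ?thesis
    using assms(2) return_solution by (simp add: sound_def)
next
  case (branch v Q x k i j C M)
  have "covered J s'"
    unfolding covered_def
  proof (intro allI impI)
    fix \<mu> assume "rbmp_feasible J \<mu> \<and> rbmp_value J \<mu> = real_of_int (layer s')"
    then have "\<exists>u\<in>#add_mset v M. complies J u \<mu>"
      using assms(2) branch by (simp add: sound_def covered_def pending_def)
    then show "\<exists>v\<in>#pending s'. complies J v \<mu>"
      using complies_child[of J v \<mu> i j] branch by (auto simp: pending_def)
  qed
  then show ?thesis
    using assms(2) branch by (simp add: sound_def)
next
  case (next_layer C k)
  have "real_of_int (k + 1) \<le> rbmp_value J \<mu>" if \<mu>: "rbmp_feasible J \<mu>" for \<mu>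
  proof -
    obtain m where m: "rbmp_value J \<mu> = real_of_int m"
      using rbmp_value_int[OF \<mu>] .
    with assms(2) next_layer \<mu> have "m \<noteq> k"
      by (auto simp: sound_def covered_def pending_def)
    moreover have "k \<le> m"
      using assms(2) next_layer \<mu> m by (force simp: sound_def)
    ultimately show ?thesis
      using m by simp
  qed
  moreover have "covered J s'"
    using next_layer complies_root by (simp add: covered_def pending_def)
  ultimately show ?thesis
    using assms(2) next_layer by (auto simp: sound_def)
qed

lemma sound_init:
  assumes "valid_lower_bound J LB"
  shows "sound J (init LB)"
  using assms complies_root
  by (auto simp: sound_def init_def covered_def pending_def valid_lower_bound_def)

lemma sound_reachable:
  assumes "valid_lower_bound J LB" and "reachable J \<tau> LB s"
  shows "sound J s"
  using assms(2) unfolding reachable_def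
  by (induction rule: rtranclp_induct) (auto intro: sound_init[OF assms(1)] sound_step)

text \<open>
  Strong duality provides the optimal solutions that the rules refer to. The only situation for
  which no rule is intended is an integral optimum of value below the layer, and soundness rules
  it out: that optimum would be a feasible solution of the master problem in an earlier layer.
\<close>

lemma process_progress:
  assumes "sound J (State C k M (Process v Q))"
  shows "\<exists>s'. step J \<tau> (State C k M (Process v Q)) s'"
proof -
  obtain \<mu> where sub: "Q \<subseteq> admissible J v" and \<mu>: "lp_feasible J Q \<mu>"
    using assms by (auto simp: sound_def)
  have sub': "Q \<subseteq> Pow (items J)"
    using sub admissible_items by blast
  obtain x \<pi> where x: "lp_optimal J Q x" and \<pi>: "dual_optimal J Q \<pi>"
    using covering_strong_duality[OF sub' \<mu>] by blast
  show ?thesis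
  proof (cases "\<forall>q\<in>admissible J v - Q. 0 \<le> reduced_cost \<pi> q")
    case True
    with x \<pi> have solved: "declared_solved J v Q x"
      by (auto simp: declared_solved_def)
    show ?thesis
    proof (cases "lp_value Q x \<le> real_of_int k")
      case False
      then show ?thesis
        using step.fathom_bound[OF declared_solved_bound[OF sub solved]] by (meson not_le)
    next
      case le: True
      show ?thesis
      proof (cases "integral_solution Q x")
        case True
        with integral_optimum_solves_rbmp[OF sub x] assms
        have "real_of_int k \<le> lp_value Q x"
          by (auto simp: sound_def)
        with le True show ?thesis
          by (meson step.return_solution[OF solved] antisym)
      next
        case False
        obtain i j where "branching_pair J \<tau> Q x (i, j)"
          using branching_pair_exists[OF fractional_pairs_nonempty[OF sub' x False]] by blast
        then show ?thesis
          using step.branch[OF solved False le] by blast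
      qed
    qed
  next
    case False
    then obtain q where q: "q \<in> admissible J v - Q" "reduced_cost \<pi> q < 0"
      by (auto simp: not_le)
    then obtain p where p: "is_arg_min (reduced_cost \<pi>) (\<lambda>q. q \<in> admissible J v - Q) p"
      using ex_is_arg_min_if_finite[of "admissible J v - Q" "reduced_cost \<pi>"] finite_admissible
      by (metis empty_iff finite_Diff)
    then have "reduced_cost \<pi> p < 0"
      using q by (fastforce simp: is_arg_min_def)
    with p x \<pi> have "priced J v Q (lp_value Q x) \<pi> (reduced_cost \<pi> p) p"
      by (auto simp: priced_def)
    then show ?thesis
      using step.fathom_pricing[of J v Q _ \<pi> _ p k] step.add_column[of J v Q _ \<pi> _ p k] by metis
  qed
qed

lemma halted_returned:
  assumes "sound J s" and "halted J \<tau> s"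
  shows "\<exists>x. phase s = Returned x"
proof (rule ccontr)
  assume not_ret: "\<not> ?thesis"
  obtain C k M ph where s: "s = State C k M ph"
    by (cases s)
  have "\<exists>s'. step J \<tau> s s'"
  proof (cases ph)
    case Select
    show ?thesis
    proof (cases M)
      case empty
      then show ?thesis
        using s Select step.next_layer by blast
    next
      case (add v M')
      then show ?thesis
        using s Select step.fathom_infeasible step.start[of "admissible J v" J v] by blast
    qed
  next
    case (Process v Q)
    then show ?thesis
      using process_progress assms(1) s by blast
  next
    case (Returned x)
    then show ?thesis
      using not_ret s by simp
  qed
  with assms(2) show False
    by (simp add: halted_def)
qed

section \<open>Termination\<close>

definition undecided :: "bmp \<Rightarrow> node \<Rightarrow> nat" where
  "undecided J v = card (items J \<times> items J - together v) + card (items J \<times> items J - separate v)"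

text \<open>
  With base 3, the weights of two children that each have fewer undecided pairs than their
  parent add up to at most two thirds of the weight of the parent.
\<close>

definition tree_weight :: "bmp \<Rightarrow> state \<Rightarrow> nat" where
  "tree_weight J s = (\<Sum>v\<in>#pending s. 3 ^ undecided J v)"

text \<open>
  Orders the steps that do not change the tree: a selected node has to be put above every column
  set with which it may be started, and each added column has to decrease the rank.
\<close>

definition phase_rank :: "bmp \<Rightarrow> state \<Rightarrow> nat" where
  "phase_rank J s = (case phase s of
     Select \<Rightarrow> card (patterns J) + 2
   | Process v Q \<Rightarrow> card (patterns J - Q) + 1
   | Returned x \<Rightarrow> 0)"

lemma card_Diff_insert_less:
  assumes "finite A" and "x \<in> A" and "x \<notin> B"
  shows "card (A - insert x B) < card (A - B)"
  using assms by (intro psubset_card_mono) auto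

lemma children_weight:
  assumes "i \<in> items J" "j \<in> items J" "(i, j) \<notin> together v" "(i, j) \<notin> separate v"
  shows "(3::nat) ^ undecided J (Node (insert (i, j) (together v)) (separate v))
    + 3 ^ undecided J (Node (together v) (insert (i, j) (separate v))) < 3 ^ undecided J v"
proof -
  have "3 * 3 ^ undecided J u \<le> (3::nat) ^ undecided J v" if "undecided J u < undecided J v" for u
    using that power_increasing[of "Suc (undecided J u)" "undecided J v" "3::nat"] by simp
  moreover have "undecided J (Node (insert (i, j) (together v)) (separate v)) < undecided J v"
    "undecided J (Node (together v) (insert (i, j) (separate v))) < undecided J v"
    using assms card_Diff_insert_less[of "items J \<times> items J" "(i, j)"]
    by (simp_all add: undecided_def finite_items)
  ultimately have "3 * 3 ^ undecided J (Node (insert (i, j) (together v)) (separate v)) \<le> (3::nat) ^ undecided J v"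
    "3 * 3 ^ undecided J (Node (together v) (insert (i, j) (separate v))) \<le> (3::nat) ^ undecided J v"
    by blast+
  moreover have "(0::nat) < 3 ^ undecided J v" by simp
  ultimately show ?thesis by linarith
qed

text \<open>
  The value \<open>m\<close> of any feasible solution, optimal or not, bounds the layer index from above, so
  a change of layer decreases \<open>m - layer s\<close>. Within a layer, fathoming, branching and returning
  decrease the weight of the tree, while starting a node and adding a column decrease the phase
  rank.
\<close>

lemma step_decreases:
  assumes "step J \<tau> s s'" and sound: "sound J s"
    and \<mu>: "rbmp_feasible J \<mu>" "rbmp_value J \<mu> = real_of_int m"
  shows "(s', s) \<in> measures [\<lambda>s. nat (m - layer s), tree_weight J, phase_rank J]"
  using assms(1)
proof (cases rule: step.cases)
  case (start Q v C k M)
  then show ?thesis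
    using card_mono[OF finite_patterns, of "patterns J - Q"]
    by (simp add: tree_weight_def pending_def phase_rank_def less_Suc_eq_le)
next
  case (add_column v Q z \<pi> c p k C M)
  then have "p \<in> admissible J v - Q"
    by (simp add: priced_def is_arg_min_def)
  then have "card (patterns J - insert p Q) < card (patterns J - Q)"
    using admissible_subset[of J v] by (intro card_Diff_insert_less[OF finite_patterns]) auto
  then show ?thesis
    using add_column by (simp add: tree_weight_def pending_def phase_rank_def)
next
  case (branch v Q x k i j C M)
  then have "i \<in> items J" "j \<in> items J" "(i, j) \<notin> together v" "(i, j) \<notin> separate v"
    using branching_pair_undecided[of Q J v x \<tau> i j] sound
    by (auto simp: sound_def declared_solved_def lp_optimal_def)
  from children_weight[OF this] show ?thesis
    using branch by (simp add: tree_weight_def pending_def)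
next
  case (next_layer C k)
  have "real_of_int (layer s') \<le> real_of_int m"
    using sound_step[OF assms(1) sound] \<mu> by (auto simp: sound_def)
  then show ?thesis
    using next_layer by simp
qed (simp_all add: tree_weight_def pending_def)

lemma no_infinite_run:
  assumes LB: "valid_lower_bound J LB" and \<mu>: "rbmp_feasible J \<mu>"
  shows "\<not> infinite_run J \<tau> LB r"
proof
  assume run: "infinite_run J \<tau> LB r"
  obtain m where m: "rbmp_value J \<mu> = real_of_int m"
    using rbmp_value_int[OF \<mu>] .
  have "sound J (r t)" for t
    using run by (induction t) (auto simp: infinite_run_def intro: sound_init[OF LB] sound_step)
  then have "(r (Suc t), r t) \<in> measures [\<lambda>s. nat (m - layer s), tree_weight J, phase_rank J]" for t
    using run \<mu> m by (intro step_decreases) (auto simp: infinite_run_def)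
  then show False
    using wf_measures wf_iff_no_infinite_down_chain by blast
qed

section \<open>Exactness\<close>

text \<open>
  The last state of a halted search has returned a solution whose value is the current layer, and
  by soundness the current layer is a lower bound on all values.
\<close>

theorem proposition3:
  fixes J :: bmp and \<tau> :: real and LB :: int
  assumes areas: "\<forall>i\<in>items J. 0 < area J i"
    and cuts: "cut_pool J \<subseteq> Pow (items J)"
    and LB: "valid_lower_bound J LB"
  shows "(\<forall>s k. reachable J \<tau> LB s \<and> k \<in> certified s \<longrightarrow>
            \<not> (\<exists>\<mu>. rbmp_feasible J \<mu> \<and> rbmp_value J \<mu> = real_of_int k))
       \<and> ((\<exists>\<mu>. rbmp_feasible J \<mu>) \<longrightarrow>
            (\<nexists>r. infinite_run J \<tau> LB r) \<and>
            (\<forall>s. reachable J \<tau> LB s \<and> halted J \<tau> s \<longrightarrow>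
               (\<exists>x. phase s = Returned x \<and> rbmp_optimal J x)))"
proof (intro conjI allI impI)
  fix s k assume "reachable J \<tau> LB s \<and> k \<in> certified s"
  then have "k < layer s" "\<forall>\<mu>. rbmp_feasible J \<mu> \<longrightarrow> real_of_int (layer s) \<le> rbmp_value J \<mu>"
    using sound_reachable[OF LB] by (auto simp: sound_def)
  then show "\<not> (\<exists>\<mu>. rbmp_feasible J \<mu> \<and> rbmp_value J \<mu> = real_of_int k)"
    by force
next
  assume "\<exists>\<mu>. rbmp_feasible J \<mu>"
  then show "\<nexists>r. infinite_run J \<tau> LB r"
    using no_infinite_run[OF LB] by blast
next
  fix s assume s: "reachable J \<tau> LB s \<and> halted J \<tau> s"
  then have "sound J s"
    using sound_reachable[OF LB] by blast
  moreover obtain x where "phase s = Returned x"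
    using halted_returned[OF \<open>sound J s\<close>] s by blast
  ultimately show "\<exists>x. phase s = Returned x \<and> rbmp_optimal J x"
    by (auto simp: sound_def rbmp_optimal_def)
qed

end
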